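(* Let $m,n$ be natural numbers. The following are equivalent for a function $\phi:[1]^m\to[1]^n$. (1) $\phi$ is an interval-preserving lattice homomorphism. (2) $\phi$ is a $\square$-morphism.
   Context: $[1]=\{0<1\}$ and $[1]^n$ is the $n$-fold product poset (a finite Boolean lattice), with $[1]^0=[0]$ a singleton; posets are regarded as categories. $\square$ is the symmetric monoidal subcategory of the Cartesian monoidal category of small categories generated by the monotone functions $\delta_{\pm}:[0]\to[1]$ ($\delta_-(0)=0$, $\delta_+(0)=1$) and $\sigma:[1]\to[0]$; equivalently, its objects are the posets $[1]^n$ and its morphisms are all composites of cofaces $[1]^{n-1}\to[1]^n$ (inserting a constant $0$ or $1$ in one coordinate), codegeneracies $[1]^{n+1}\to[1]^n$ (projections omitting one coordinate) and coordinate permutations. A lattice homomorphism is a function between lattices preserving binary suprema and binary infima. An interval in a poset is an order-convex subposet having both a minimum and a maximum. A monotone function between finite lattices is interval-preserving if the image of every interval is an interval. *)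

theory Defs
  imports Main "HOL-Library.FuncSet"
begin

text \<open>The poset \<open>[1]\<close> is the type \<^typ>\<open>bool\<close> with \<open>False < True\<close>, and \<open>[1]^n\<close> is its
  \<open>n\<close>-fold product. Elements of \<open>cube n\<close> all take the value \<open>undefined\<close> outside \<open>{..<n}\<close>, so the
  pointwise order, supremum and infimum of \<^typ>\<open>nat \<Rightarrow> bool\<close> restrict to those of the product
  lattice (see \<open>le_cube_iff\<close>, \<open>sup_in_cube\<close>, \<open>inf_in_cube\<close>).\<close>

type_synonym vertex = "nat \<Rightarrow> bool"

definition cube :: "nat \<Rightarrow> vertex set" where
  "cube n = {..<n} \<rightarrow>\<^sub>E (UNIV :: bool set)"

lemma le_cube_iff:
  assumes "x \<in> cube n" "y \<in> cube n"
  shows "x \<le> y \<longleftrightarrow> (\<forall>i<n. x i \<le> y i)"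
proof
  assume *: "\<forall>i<n. x i \<le> y i"
  show "x \<le> y"
  proof (rule le_funI)
    fix i show "x i \<le> y i"
      using * assms by (cases "i < n") (auto simp: cube_def PiE_def extensional_def)
  qed
qed (simp add: le_fun_def)

lemma sup_in_cube: "x \<in> cube n \<Longrightarrow> y \<in> cube n \<Longrightarrow> sup x y \<in> cube n"
  by (auto simp: cube_def PiE_def extensional_def)

lemma inf_in_cube: "x \<in> cube n \<Longrightarrow> y \<in> cube n \<Longrightarrow> inf x y \<in> cube n"
  by (auto simp: cube_def PiE_def extensional_def)


text \<open>The carriers \<open>A\<close>, \<open>B\<close> are meant to be closed under \<^const>\<open>sup\<close> and \<^const>\<open>inf\<close>, so that
  these are the binary suprema and infima in \<open>A\<close> and in \<open>B\<close>.\<close>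

definition lattice_homomorphism :: "'a::lattice set \<Rightarrow> 'b::lattice set \<Rightarrow> ('a \<Rightarrow> 'b) \<Rightarrow> bool" where
  "lattice_homomorphism A B f \<longleftrightarrow> f \<in> A \<rightarrow> B \<and>
     (\<forall>x\<in>A. \<forall>y\<in>A. f (sup x y) = sup (f x) (f y) \<and> f (inf x y) = inf (f x) (f y))"

definition interval_in :: "'a::order set \<Rightarrow> 'a set \<Rightarrow> bool" where
  "interval_in A S \<longleftrightarrow> S \<subseteq> A \<and>
     (\<forall>x\<in>S. \<forall>z\<in>S. \<forall>y\<in>A. x \<le> y \<and> y \<le> z \<longrightarrow> y \<in> S) \<and>
     (\<exists>a\<in>S. \<forall>x\<in>S. a \<le> x) \<and> (\<exists>b\<in>S. \<forall>x\<in>S. x \<le> b)"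

definition interval_preserving :: "'a::order set \<Rightarrow> 'b::order set \<Rightarrow> ('a \<Rightarrow> 'b) \<Rightarrow> bool" where
  "interval_preserving A B f \<longleftrightarrow> f \<in> A \<rightarrow> B \<and> mono_on A f \<and>
     (\<forall>S. interval_in A S \<longrightarrow> interval_in B (f ` S))"


text \<open>Functions \<open>[1]^m \<rightarrow> [1]^n\<close> are elements of \<open>cube m \<rightarrow>\<^sub>E cube n\<close>. The object \<open>[1]^(m + n)\<close> is
  \<open>[1]^m \<times> [1]^n\<close>, coordinates \<open>m, ..., m + n - 1\<close> being those of the second factor.\<close>

definition cube_fst :: "nat \<Rightarrow> vertex \<Rightarrow> vertex" where
  "cube_fst m x = (\<lambda>i\<in>{..<m}. x i)"

definition cube_snd :: "nat \<Rightarrow> nat \<Rightarrow> vertex \<Rightarrow> vertex" where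
  "cube_snd m n x = (\<lambda>i\<in>{..<n}. x (m + i))"

definition cube_pair :: "nat \<Rightarrow> nat \<Rightarrow> vertex \<Rightarrow> vertex \<Rightarrow> vertex" where
  "cube_pair m n x y = (\<lambda>i\<in>{..<m + n}. if i < m then x i else y (i - m))"

definition tensor ::
    "nat \<Rightarrow> nat \<Rightarrow> nat \<Rightarrow> nat \<Rightarrow> (vertex \<Rightarrow> vertex) \<Rightarrow> (vertex \<Rightarrow> vertex) \<Rightarrow> vertex \<Rightarrow> vertex" where
  "tensor m n m' n' f g =
     (\<lambda>x\<in>cube (m + m'). cube_pair n n' (f (cube_fst m x)) (g (cube_snd m m' x)))"

definition symmetry :: "nat \<Rightarrow> nat \<Rightarrow> vertex \<Rightarrow> vertex" where
  "symmetry m n = (\<lambda>x\<in>cube (m + n). cube_pair n m (cube_snd m n x) (cube_fst m x))"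

definition delta :: "bool \<Rightarrow> vertex \<Rightarrow> vertex" where
  "delta b = (\<lambda>x\<in>cube 0. \<lambda>i\<in>{..<1}. b)"

text \<open>The unique element of \<open>cube 0\<close> is \<open>\<lambda>i. undefined\<close>.\<close>

definition sigma :: "vertex \<Rightarrow> vertex" where
  "sigma = (\<lambda>x\<in>cube 1. \<lambda>i. undefined)"

text \<open>The smallest symmetric monoidal subcategory containing \<open>\<delta>\<^sub>- = delta False\<close>,
  \<open>\<delta>\<^sub>+ = delta True\<close> and \<open>\<sigma>\<close>; \<open>box_morphism m n f\<close> says that \<open>f\<close> is one of its morphisms
  \<open>[1]^m \<rightarrow> [1]^n\<close>.\<close>

inductive box_morphism :: "nat \<Rightarrow> nat \<Rightarrow> (vertex \<Rightarrow> vertex) \<Rightarrow> bool" where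
  box_delta_minus: "box_morphism 0 1 (delta False)"
| box_delta_plus: "box_morphism 0 1 (delta True)"
| box_sigma: "box_morphism 1 0 sigma"
| box_id: "box_morphism n n (\<lambda>x\<in>cube n. x)"
| box_comp: "box_morphism l m f \<Longrightarrow> box_morphism m n g \<Longrightarrow> box_morphism l n (compose (cube l) g f)"
| box_tensor: "box_morphism m n f \<Longrightarrow> box_morphism m' n' g \<Longrightarrow>
    box_morphism (m + m') (n + n') (tensor m n m' n' f g)"
| box_symmetry: "box_morphism (m + n) (n + m) (symmetry m n)"

lemma cube_pair_in_cube: "cube_pair m n x y \<in> cube (m + n)"
  by (simp add: cube_def cube_pair_def)

lemma box_morphism_in_funcset: "box_morphism m n f \<Longrightarrow> f \<in> cube m \<rightarrow>\<^sub>E cube n"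
proof (induction rule: box_morphism.induct)
  case box_delta_minus
  show ?case unfolding delta_def by (rule restrict_PiE_iff[THEN iffD2]) (simp add: cube_def)
next
  case box_delta_plus
  show ?case unfolding delta_def by (rule restrict_PiE_iff[THEN iffD2]) (simp add: cube_def)
next
  case box_sigma
  show ?case unfolding sigma_def by (rule restrict_PiE_iff[THEN iffD2]) (simp add: cube_def)
next
  case (box_id n)
  show ?case by (rule restrict_PiE_iff[THEN iffD2]) simp
next
  case (box_comp l m f n g)
  show ?case unfolding compose_def
    by (rule restrict_PiE_iff[THEN iffD2]) (use box_comp.IH in \<open>blast dest: PiE_mem\<close>)
next
  case (box_tensor m n f m' n' g)
  show ?case unfolding tensor_def
    by (rule restrict_PiE_iff[THEN iffD2]) (simp add: cube_pair_in_cube)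
next
  case (box_symmetry m n)
  show ?case unfolding symmetry_def
    by (rule restrict_PiE_iff[THEN iffD2]) (simp add: cube_pair_in_cube)
qed

end

theory Submission
  imports Defs
begin

text \<open>Both conditions say that each coordinate of \<open>\<phi> x\<close> is either a constant or a coordinate
  \<open>x (p i)\<close> of \<open>x\<close>, where no coordinate of \<open>x\<close> is used twice. The maps of this form contain the
  generators and are closed under composition and tensor product, and every one of them is built
  from generators by peeling off its last output coordinate. A lattice homomorphism to \<open>[1]\<close> is a
  constant or a projection, since a nonconstant one is true at some atom. Finally, if one input
  coordinate were duplicated, the image of \<open>[1]^m\<close> would not be order-convex.\<close>

section \<open>Wirings: coordinates copied or held constant\<close>

definition wiring :: "nat \<Rightarrow> nat \<Rightarrow> nat set \<Rightarrow> (nat \<Rightarrow> nat) \<Rightarrow> (nat \<Rightarrow> bool) \<Rightarrow> vertex \<Rightarrow> vertex" where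
  "wiring m n I p c = (\<lambda>x\<in>cube m. \<lambda>i\<in>{..<n}. if i \<in> I then x (p i) else c i)"

text \<open>Injectivity of \<open>p\<close> on \<open>I\<close> excludes diagonals. Inputs missed by
  \<open>p\<close> are discarded, which accounts for \<open>sigma\<close>, and outputs outside
  \<open>I\<close> are constant, which accounts for the two maps \<open>delta\<close>.\<close>

definition is_wiring :: "nat \<Rightarrow> nat \<Rightarrow> (vertex \<Rightarrow> vertex) \<Rightarrow> bool" where
  "is_wiring m n f \<longleftrightarrow>
     (\<exists>I p c. I \<subseteq> {..<n} \<and> p \<in> I \<rightarrow> {..<m} \<and> inj_on p I \<and> f = wiring m n I p c)"

lemma is_wiringI:
  "I \<subseteq> {..<n} \<Longrightarrow> p \<in> I \<rightarrow> {..<m} \<Longrightarrow> inj_on p I \<Longrightarrow> f = wiring m n I p c \<Longrightarrow> is_wiring m n f"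
  unfolding is_wiring_def by blast

lemma cube_eqI:
  assumes "x \<in> cube n" "y \<in> cube n" "\<And>i. i < n \<Longrightarrow> x i = y i"
  shows "x = y"
  using assms unfolding cube_def by (intro PiE_ext) auto

lemma restrict_in_cube [simp]: "restrict x {..<n} \<in> cube n"
  by (simp add: cube_def)

lemma wiring_in_cube: "x \<in> cube m \<Longrightarrow> wiring m n I p c x \<in> cube n"
  by (simp add: wiring_def)

lemma wiring_apply:
  "x \<in> cube m \<Longrightarrow> i < n \<Longrightarrow> wiring m n I p c x i = (if i \<in> I then x (p i) else c i)"
  by (simp add: wiring_def)

lemma eq_wiringI:
  assumes "f \<in> cube m \<rightarrow>\<^sub>E cube n"
    and "\<And>x i. x \<in> cube m \<Longrightarrow> i < n \<Longrightarrow> f x i = (if i \<in> I then x (p i) else c i)"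
  shows "f = wiring m n I p c"
proof (rule PiE_ext[OF assms(1)])
  show "wiring m n I p c \<in> cube m \<rightarrow>\<^sub>E cube n" by (simp add: wiring_def)
next
  fix x assume x: "x \<in> cube m"
  show "f x = wiring m n I p c x"
    by (rule cube_eqI[of _ n])
      (use x assms in \<open>auto simp: wiring_in_cube wiring_apply dest: PiE_mem\<close>)
qed

lemma cube_fst_in_cube: "cube_fst m x \<in> cube m"
  by (simp add: cube_fst_def)

lemma cube_snd_in_cube: "cube_snd m n x \<in> cube n"
  by (simp add: cube_snd_def)

text \<open>Follow each output of \<open>g\<close> backwards: it reaches an input of
  \<open>f\<close> exactly when \<open>g\<close> wires it to a coordinate that \<open>f\<close>
  wires in turn. Otherwise it ends at a constant of \<open>g\<close> or at one of
  \<open>f\<close>.\<close>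

lemma is_wiring_comp:
  assumes "is_wiring l m f" "is_wiring m n g"
  shows "is_wiring l n (compose (cube l) g f)"
proof -
  from assms obtain I p c J q d where
    f: "I \<subseteq> {..<m}" "p \<in> I \<rightarrow> {..<l}" "inj_on p I" "f = wiring l m I p c" and
    g: "J \<subseteq> {..<n}" "q \<in> J \<rightarrow> {..<m}" "inj_on q J" "g = wiring m n J q d"
    unfolding is_wiring_def by blast
  show ?thesis
  proof (rule is_wiringI)
    show "{i \<in> J. q i \<in> I} \<subseteq> {..<n}" "p \<circ> q \<in> {i \<in> J. q i \<in> I} \<rightarrow> {..<l}"
      using f g by auto
    show "inj_on (p \<circ> q) {i \<in> J. q i \<in> I}"
      using f(3) g(3) by (auto simp: inj_on_def)
    \<comment> \<open>The constant \<open>c (q i)\<close> occurs when the wire of \<open>g\<close>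
      stops at a constant coordinate of \<open>f\<close>.\<close>
    show "compose (cube l) g f =
      wiring l n {i \<in> J. q i \<in> I} (p \<circ> q) (\<lambda>i. if i \<in> J then c (q i) else d i)"
      by (rule eq_wiringI)
        (use g(2) in \<open>auto simp: f(4) g(4) compose_def wiring_in_cube wiring_apply Pi_iff\<close>)
  qed
qed

text \<open>The two wirings run side by side, the second shifted by \<open>n\<close> on outputs and
  by \<open>m\<close> on inputs.\<close>

lemma is_wiring_tensor:
  assumes "is_wiring m n f" "is_wiring m' n' g"
  shows "is_wiring (m + m') (n + n') (tensor m n m' n' f g)"
proof -
  from assms obtain I p c J q d where
    f: "I \<subseteq> {..<n}" "p \<in> I \<rightarrow> {..<m}" "inj_on p I" "f = wiring m n I p c" and
    g: "J \<subseteq> {..<n'}" "q \<in> J \<rightarrow> {..<m'}" "inj_on q J" "g = wiring m' n' J q d"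
    unfolding is_wiring_def by blast
  let ?K = "I \<union> {i. n \<le> i \<and> i - n \<in> J}"
  let ?r = "\<lambda>i. if i < n then p i else m + q (i - n)"
  show ?thesis
  proof (rule is_wiringI)
    show "?K \<subseteq> {..<n + n'}" using f(1) g(1) by fastforce
    show "?r \<in> ?K \<rightarrow> {..<m + m'}" using f(1,2) g(2) by (fastforce simp: Pi_iff)
    have p: "p i < m" if "i \<in> I" for i using that f(2) by auto
    show "inj_on ?r ?K"
    proof (rule inj_onI)
      fix i j assume ij: "i \<in> ?K" "j \<in> ?K" "?r i = ?r j"
      show "i = j"
      \<comment> \<open>In the mixed cases the two values of \<open>?r\<close> cannot agree: wires
        of the first factor end below \<open>m\<close>, those of the second at \<open>m\<close> or
        above.\<close>
      proof (cases "i < n"; cases "j < n")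
        assume "i < n" "j < n" then show ?thesis using ij f(3) by (auto dest: inj_onD)
      next
        assume "i < n" "\<not> j < n" then show ?thesis using ij p[of i] by auto
      next
        assume "\<not> i < n" "j < n" then show ?thesis using ij p[of j] by auto
      next
        assume *: "\<not> i < n" "\<not> j < n"
        then have "i - n \<in> J" "j - n \<in> J" "q (i - n) = q (j - n)" using ij f(1) by auto
        then show ?thesis using g(3) * by (auto dest: inj_onD)
      qed
    qed
    show "tensor m n m' n' f g =
      wiring (m + m') (n + n') ?K ?r (\<lambda>i. if i < n then c i else d (i - n))"
    proof (rule eq_wiringI)
      show "tensor m n m' n' f g \<in> cube (m + m') \<rightarrow>\<^sub>E cube (n + n')"
        by (simp add: tensor_def cube_pair_in_cube)
    next
      fix x i assume x: "x \<in> cube (m + m')" and i: "i < n + n'"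
      have q: "q j < m'" if "j \<in> J" for j using that g(2) by auto
      show "tensor m n m' n' f g x i =
        (if i \<in> ?K then x (?r i) else if i < n then c i else d (i - n))"
        using x i f(1) p q
        by (auto simp: tensor_def cube_pair_def f(4) g(4) wiring_apply cube_fst_in_cube
            cube_snd_in_cube) (auto simp: cube_fst_def cube_snd_def)
    qed
  qed
qed

lemma is_wiring_box_morphism: "box_morphism m n f \<Longrightarrow> is_wiring m n f"
proof (induction rule: box_morphism.induct)
  case box_delta_minus
  show ?case
    by (rule is_wiringI[where I = "{}" and c = "\<lambda>_. False"]) (auto simp: delta_def wiring_def)
next
  case box_delta_plus
  show ?case
    by (rule is_wiringI[where I = "{}" and c = "\<lambda>_. True"]) (auto simp: delta_def wiring_def)
next
  case box_sigma
  show ?case by (rule is_wiringI[where I = "{}"]) (auto simp: sigma_def wiring_def restrict_def)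
next
  case (box_id n)
  show ?case
    by (rule is_wiringI[where I = "{..<n}" and p = id]) (auto intro!: eq_wiringI)
next
  case (box_symmetry m n)
  show ?case
  proof (rule is_wiringI)
    \<comment> \<open>The block swap: the first \<open>n\<close> outputs read the second input
      block, the remaining \<open>m\<close> the first.\<close>
    show "(\<lambda>i. if i < n then m + i else i - n) \<in> {..<n + m} \<rightarrow> {..<m + n}"
      "inj_on (\<lambda>i. if i < n then m + i else i - n) {..<n + m}"
      by (auto simp: inj_on_def)
    show "symmetry m n =
      wiring (m + n) (n + m) {..<n + m} (\<lambda>i. if i < n then m + i else i - n) undefined"
      by (rule eq_wiringI)
        (auto simp: symmetry_def cube_pair_in_cube cube_pair_def cube_fst_def cube_snd_def)
  qed simp
qed (auto intro: is_wiring_comp is_wiring_tensor)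

section \<open>Every wiring is built from generators\<close>

lemma box_morphism_to_point: "box_morphism m 0 (\<lambda>x\<in>cube m. \<lambda>i. undefined)"
proof (induction m)
  case 0
  \<comment> \<open>\<open>cube 0\<close> has a single point, so the map to the point is already the
    identity.\<close>
  have "(\<lambda>x\<in>cube 0. \<lambda>i. undefined) = (\<lambda>x\<in>cube 0. x)"
    by (auto simp: cube_def)
  then show ?case using box_id[of 0] by (simp only:)
next
  case (Suc m)
  \<comment> \<open>Each further coordinate is discarded by one more \<open>sigma\<close>.\<close>
  have "tensor m 0 1 0 (\<lambda>x\<in>cube m. \<lambda>i. undefined) sigma = (\<lambda>x\<in>cube (Suc m). \<lambda>i. undefined)"
    by (auto simp: tensor_def cube_pair_def restrict_def)
  then show ?case using box_tensor[OF Suc box_sigma] by (simp only: add_0 Suc_eq_plus1)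
qed

text \<open>This cyclic permutation takes input \<open>j\<close> to the last place and keeps the
  order of the others. A single block swap of one coordinate past the \<open>m - j\<close> later
  ones achieves it, with the first \<open>j\<close> held fixed.\<close>

lemma box_morphism_move_last:
  assumes "j < Suc m"
  shows "box_morphism (Suc m) (Suc m)
    (wiring (Suc m) (Suc m) {..<Suc m} (\<lambda>i. if i < j then i else if i < m then Suc i else j) c)"
proof -
  define r where "r = m - j"
  have m: "m = j + r" using assms by (simp add: r_def)
  let ?f = "tensor j j (1 + r) (r + 1) (\<lambda>x\<in>cube j. x) (symmetry 1 r)"
  have box: "box_morphism (j + (1 + r)) (j + (r + 1)) ?f"
    by (intro box_tensor box_id box_symmetry)
  have "?f = wiring (Suc m) (Suc m) {..<Suc m} (\<lambda>i. if i < j then i else if i < m then Suc i else j) c"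
  proof (rule eq_wiringI)
    show "?f \<in> cube (Suc m) \<rightarrow>\<^sub>E cube (Suc m)"
      using box_morphism_in_funcset[OF box] by (simp add: m)
  next
    fix x i assume "x \<in> cube (Suc m)" "i < Suc m"
    then show "?f x i =
      (if i \<in> {..<Suc m} then x (if i < j then i else if i < m then Suc i else j) else c i)"
      by (auto simp: m tensor_def symmetry_def cube_pair_def cube_fst_in_cube cube_snd_in_cube)
        (auto simp: cube_fst_def cube_snd_def less_Suc_eq Suc_diff_le split: if_splits)
  qed
  with box show ?thesis by (simp add: m)
qed

text \<open>Induction on the number of outputs. A constant last output is split off as a
  \<open>delta\<close>. If it copies an input, that input is first moved to the end, and the wire
  then splits off as an identity on one coordinate. This also removes an input, so \<open>m\<close>,
  \<open>I\<close> and \<open>p\<close> vary in the induction.\<close>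

lemma box_morphism_wiring:
  assumes "I \<subseteq> {..<n}" "p \<in> I \<rightarrow> {..<m}" "inj_on p I"
  shows "box_morphism m n (wiring m n I p c)"
  using assms
proof (induction n arbitrary: m I p)
  case 0
  have "wiring m 0 I p c = (\<lambda>x\<in>cube m. \<lambda>i. undefined)"
    by (auto simp: wiring_def restrict_def)
  then show ?case by (simp only: box_morphism_to_point)
next
  case (Suc n)
  show ?case
  proof (cases "n \<in> I")
    case False
    then have I: "I \<subseteq> {..<n}" using Suc.prems(1) by (simp add: lessThan_Suc subset_insert)
    let ?f = "tensor m n 0 1 (wiring m n I p c) (delta (c n))"
    have "box_morphism 0 1 (delta (c n))"
      using box_delta_minus box_delta_plus by (cases "c n") simp_all
    then have box: "box_morphism (m + 0) (n + 1) ?f"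
      by (intro box_tensor Suc.IH I Suc.prems)
    have "?f = wiring m (Suc n) I p c"
    proof (rule eq_wiringI)
      show "?f \<in> cube m \<rightarrow>\<^sub>E cube (Suc n)" using box_morphism_in_funcset[OF box] by simp
    next
      fix x i assume "x \<in> cube m" "i < Suc n"
      moreover have "p i < m" if "i \<in> I" using that Suc.prems(2) by auto
      ultimately show "?f x i = (if i \<in> I then x (p i) else c i)"
        using False cube_snd_in_cube[of m 0 x]
        by (auto simp: tensor_def cube_pair_def wiring_apply cube_fst_in_cube delta_def less_Suc_eq)
          (auto simp: cube_fst_def)
    qed
    with box show ?thesis by simp
  next
    case True
    define j where "j = p n"
    have "j < m" using True Suc.prems(2) by (auto simp: j_def)
    then obtain k where m: "m = Suc k" by (cases m) auto
    \<comment> \<open>Renumbering of the inputs after deleting \<open>j\<close>: those above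
      \<open>j\<close> drop by one.\<close>
    define q where "q i = (if p i < j then p i else p i - 1)" for i
    \<comment> \<open>By injectivity of \<open>p\<close>, the deleted input \<open>j\<close> feeds
      the last output only.\<close>
    have ne: "p i \<noteq> j" if "i \<in> I" "i < n" for i
      using inj_onD[OF Suc.prems(3) _ that(1) True] that(2) by (auto simp: j_def)
    have lt: "p i < Suc k" if "i \<in> I" for i using that Suc.prems(2) by (auto simp: m)
    have "box_morphism k n (wiring k n (I - {n}) q c)"
    proof (rule Suc.IH)
      show I: "I - {n} \<subseteq> {..<n}" using Suc.prems(1) by (auto simp: lessThan_Suc)
      show "q \<in> I - {n} \<rightarrow> {..<k}"
      proof
        fix i assume "i \<in> I - {n}"
        then show "q i \<in> {..<k}"
          using ne[of i] lt[of i] I \<open>j < m\<close> by (auto simp: q_def m)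
      qed
      show "inj_on q (I - {n})"
      proof (rule inj_onI)
        fix i i' assume i: "i \<in> I - {n}" "i' \<in> I - {n}" "q i = q i'"
        then have "p i \<noteq> j" "p i' \<noteq> j" using ne I by auto
        then have "p i = p i'" using i(3) by (auto simp: q_def split: if_splits)
        then show "i = i'" using i Suc.prems(3) by (auto dest: inj_onD)
      qed
    qed
    then have box2: "box_morphism (k + 1) (n + 1)
        (tensor k n 1 1 (wiring k n (I - {n}) q c) (\<lambda>x\<in>cube 1. x))" (is "box_morphism _ _ ?g")
      by (intro box_tensor box_id)
    let ?s = "\<lambda>i. if i < j then i else if i < k then Suc i else j"
    let ?h = "wiring m m {..<m} ?s c"
    have box1: "box_morphism m m ?h"
      using box_morphism_move_last[of j k c] \<open>j < m\<close> by (simp add: m)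
    have box: "box_morphism m (Suc n) (compose (cube m) ?g ?h)"
      using box_comp[OF box1] box2 by (simp add: m)
    have "compose (cube m) ?g ?h = wiring m (Suc n) I p c"
    proof (rule eq_wiringI)
      show "compose (cube m) ?g ?h \<in> cube m \<rightarrow>\<^sub>E cube (Suc n)"
        using box_morphism_in_funcset[OF box] .
    next
      fix x i assume x: "x \<in> cube m" and i: "i < Suc n"
      have hx: "?h x \<in> cube (k + 1)" using x wiring_in_cube m by simp
      have h: "?h x a = x (?s a)" if "a < m" for a using x that by (simp add: wiring_apply)
      show "compose (cube m) ?g ?h x i = (if i \<in> I then x (p i) else c i)"
      proof (cases "i = n")
        case True
        then show ?thesis
          using x hx h[of k] \<open>n \<in> I\<close> \<open>j < m\<close>
          by (simp add: compose_def tensor_def cube_pair_def cube_snd_in_cube)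
            (auto simp: cube_snd_def m j_def)
      next
        case False
        with i have "i < n" by simp
        have "?g (?h x) i = (if i \<in> I then cube_fst k (?h x) (q i) else c i)"
          using hx \<open>i < n\<close> by (simp add: tensor_def cube_pair_def wiring_apply cube_fst_in_cube)
        also have "\<dots> = (if i \<in> I then x (p i) else c i)"
        proof (cases "i \<in> I")
          case True
          \<comment> \<open>On inputs other than \<open>j\<close>, the permutation \<open>?s\<close>
            undoes the renumbering.\<close>
          then have "q i < k" "?s (q i) = p i"
            using ne[of i] lt[of i] \<open>i < n\<close> \<open>j < m\<close> by (auto simp: q_def m)
          then show ?thesis using True h[of "q i"] by (simp add: cube_fst_def m)
        qed simp
        finally show ?thesis using x by (simp add: compose_def)
      qed
    qed
    with box show ?thesis by simp
  qed
qed

lemma box_morphism_iff_is_wiring: "box_morphism m n f \<longleftrightarrow> is_wiring m n f"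
  using is_wiring_box_morphism box_morphism_wiring unfolding is_wiring_def by blast

section \<open>Wirings preserve the lattice operations and intervals\<close>

lemma mono_on_wiring: "mono_on (cube m) (wiring m n I p c)"
proof (rule mono_onI)
  fix x y assume "x \<in> cube m" "y \<in> cube m" "x \<le> y"
  then show "wiring m n I p c x \<le> wiring m n I p c y"
    by (subst le_cube_iff[of _ n]) (auto simp: wiring_in_cube wiring_apply le_fun_def)
qed

lemma lattice_homomorphism_wiring:
  "lattice_homomorphism (cube m) (cube n) (wiring m n I p c)"
  unfolding lattice_homomorphism_def
  by (auto intro!: cube_eqI[of _ n] simp: wiring_in_cube wiring_apply sup_in_cube inf_in_cube)

text \<open>Order-convexity fills in everything between the minimum and the maximum, so an interval
  can be handled through its two endpoints.\<close>

lemma interval_in_iff: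
  "interval_in A S \<longleftrightarrow> (\<exists>a\<in>A. \<exists>b\<in>A. a \<le> b \<and> S = {x \<in> A. a \<le> x \<and> x \<le> b})" (is "?L \<longleftrightarrow> ?R")
proof
  assume ?L
  then obtain a b where "a \<in> S" "b \<in> S" "\<forall>x\<in>S. a \<le> x" "\<forall>x\<in>S. x \<le> b" "S \<subseteq> A"
    "\<forall>x\<in>S. \<forall>z\<in>S. \<forall>y\<in>A. x \<le> y \<and> y \<le> z \<longrightarrow> y \<in> S"
    unfolding interval_in_def by blast
  moreover from this have "S = {x \<in> A. a \<le> x \<and> x \<le> b}" by blast
  ultimately show ?R by blast
next
  assume ?R
  then obtain a b where "a \<in> A" "b \<in> A" "a \<le> b" "S = {x \<in> A. a \<le> x \<and> x \<le> b}" by blast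
  then show ?L unfolding interval_in_def by (auto intro: order_trans)
qed

text \<open>The image of the interval from \<open>a\<close> to \<open>b\<close> is the whole
  interval between the images of \<open>a\<close> and \<open>b\<close>. Since no input is used
  twice, the coordinates of a point in between can be pulled back independently.\<close>

lemma interval_preserving_wiring:
  assumes I: "I \<subseteq> {..<n}" and p: "p \<in> I \<rightarrow> {..<m}" "inj_on p I"
  shows "interval_preserving (cube m) (cube n) (wiring m n I p c)"
  unfolding interval_preserving_def
proof (intro conjI allI impI mono_on_wiring)
  let ?f = "wiring m n I p c"
  show "?f \<in> cube m \<rightarrow> cube n" by (simp add: wiring_in_cube)
  fix S assume "interval_in (cube m) S"
  then obtain a b where abm: "a \<in> cube m" "b \<in> cube m" and ab: "a \<le> b"
    and S: "S = {x \<in> cube m. a \<le> x \<and> x \<le> b}"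
    unfolding interval_in_iff by (elim bexE conjE)
  have le: "?f x \<le> ?f y" if "x \<in> cube m" "y \<in> cube m" "x \<le> y" for x y
    using that by (rule mono_onD[OF mono_on_wiring])
  have "?f ` S = {y \<in> cube n. ?f a \<le> y \<and> y \<le> ?f b}"
  proof (intro equalityI subsetI)
    fix y assume "y \<in> ?f ` S"
    then show "y \<in> {y \<in> cube n. ?f a \<le> y \<and> y \<le> ?f b}"
      using abm le S by (elim imageE) (simp add: wiring_in_cube)
  next
    fix y assume "y \<in> {y \<in> cube n. ?f a \<le> y \<and> y \<le> ?f b}"
    then have y: "y \<in> cube n" and fa: "?f a \<le> y" and fb: "y \<le> ?f b" by simp_all
    \<comment> \<open>The preimage takes its wired inputs from \<open>y\<close> through the inverse
      of \<open>p\<close>; every other input takes its value from \<open>a\<close>, which keeps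
      \<open>x\<close> between \<open>a\<close> and \<open>b\<close>.\<close>
    define x where "x = (\<lambda>j\<in>{..<m}. if j \<in> p ` I then y (the_inv_into I p j) else a j)"
    have xm: "x \<in> cube m" by (simp add: x_def)
    have xp: "x (p i) = y i" if "i \<in> I" for i
      using that p by (auto simp: x_def the_inv_into_f_f)
    have iv: "a (p i) \<le> y i" "y i \<le> b (p i)" if "i \<in> I" for i
      using that I abm le_funD[OF fa, of i] le_funD[OF fb, of i] by (auto simp: wiring_apply)
    have "a \<le> x \<and> x \<le> b"
      unfolding le_cube_iff[OF abm(1) xm] le_cube_iff[OF xm abm(2)]
    proof (intro conjI allI impI)
      fix j assume "j < m"
      moreover have "a j \<le> b j" using le_funD[OF ab] .
      ultimately show "a j \<le> x j" "x j \<le> b j"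
        by (cases "j \<in> p ` I"; use iv xp in \<open>force simp: x_def\<close>)+
    qed
    then have "x \<in> S" using xm S by simp
    moreover have "?f x = y"
    proof (rule cube_eqI[of _ n])
      fix i assume i: "i < n"
      show "?f x i = y i"
      proof (cases "i \<in> I")
        \<comment> \<open>At a constant output \<open>?f a\<close> and \<open>?f b\<close> agree,
          which squeezes \<open>y\<close>.\<close>
        case False
        then show ?thesis
          using i abm xm le_funD[OF fa, of i] le_funD[OF fb, of i] by (auto simp: wiring_apply)
      qed (use i xm xp in \<open>simp add: wiring_apply\<close>)
    qed (use xm y in \<open>simp_all add: wiring_in_cube\<close>)
    ultimately show "y \<in> ?f ` S" by blast
  qed
  then show "interval_in (cube n) (?f ` S)"
    unfolding interval_in_iff using abm ab le
    by (intro bexI[of _ "?f a"] bexI[of _ "?f b"]) (simp_all add: wiring_in_cube)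
qed

section \<open>From interval-preserving homomorphisms to wirings\<close>

text \<open>The points where coordinate \<open>i\<close> of \<open>f\<close> is true are closed
  upwards and under meets, and a join lies among them only if one of its parts does. Unless all or
  no points qualify, some atom does, and the qualifying points are exactly those above it.\<close>

lemma lattice_homomorphism_coordinate:
  assumes hom: "lattice_homomorphism (cube m) (cube n) f"
  shows "(\<exists>j<m. \<forall>x\<in>cube m. f x i = x j) \<or> (\<exists>c. \<forall>x\<in>cube m. f x i = c)"
proof -
  have sup: "f (sup x y) i = (f x i \<or> f y i)" and inf: "f (inf x y) i = (f x i \<and> f y i)"
    if "x \<in> cube m" "y \<in> cube m" for x y
    using hom that unfolding lattice_homomorphism_def by auto
  have mono: "f y i" if "f x i" "x \<le> y" "x \<in> cube m" "y \<in> cube m" for x y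
    using sup[of x y] that by (simp add: sup_absorb2)
  \<comment> \<open>The \<open>b k\<close> climb from bottom to top by adding one atom
    \<open>e k\<close> at a time.\<close>
  define b where "b k = (\<lambda>l\<in>{..<m}. l < k)" for k
  define e where "e k = (\<lambda>l\<in>{..<m}. l = k)" for k :: nat
  have be [simp]: "b k \<in> cube m" "e k \<in> cube m" for k by (simp_all add: b_def e_def)
  have bot: "b 0 \<le> x" and top: "x \<le> b m" if "x \<in> cube m" for x
    using that by (simp_all add: le_cube_iff[of _ m]) (simp_all add: b_def)
  consider "f (b 0) i" | "\<not> f (b m) i" | "\<not> f (b 0) i" "f (b m) i" by blast
  then show ?thesis
  proof cases
    case 1
    then have "\<forall>x\<in>cube m. f x i = True" using mono bot be by blast
    then show ?thesis by blast
  next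
    case 2
    then have "\<forall>x\<in>cube m. f x i = False" using mono top be by blast
    then show ?thesis by blast
  next
    case 3
    \<comment> \<open>The first jump along the chain singles out the atom
      \<open>e j\<close>.\<close>
    then obtain j where j: "j < m" "\<not> f (b j) i" "f (b (Suc j)) i"
      using ex_least_nat_less[of "\<lambda>k. f (b k) i" m] by blast
    have "b (Suc j) = sup (b j) (e j)"
      by (rule cube_eqI[of _ m]) (auto simp: sup_in_cube, auto simp: b_def e_def)
    then have ej: "f (e j) i" using j sup[of "b j" "e j"] by simp
    have "f x i = x j" if x: "x \<in> cube m" for x
    proof (cases "x j")
      case True
      then have "e j \<le> x" using x by (simp add: le_cube_iff[of _ m]) (simp add: e_def)
      then show ?thesis using True mono ej x by simp
    next
      case False
      \<comment> \<open>If \<open>x\<close> were sent to true, so would be its meet with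
        \<open>e j\<close>, but that meet is the bottom.\<close>
      then have "inf x (e j) = b 0"
        using x by (intro cube_eqI[of _ m]) (auto simp: inf_in_cube, auto simp: b_def e_def)
      then show ?thesis using inf[of x "e j"] x ej 3 False by simp
    qed
    then show ?thesis using j by blast
  qed
qed

lemma interval_in_cube: "interval_in (cube m) (cube m)"
proof -
  have "(\<lambda>i\<in>{..<m}. False) \<le> x" "x \<le> (\<lambda>i\<in>{..<m}. True)" if "x \<in> cube m" for x
    using that by (simp_all add: le_cube_iff[of _ m])
  then show ?thesis unfolding interval_in_def using restrict_in_cube by blast
qed

text \<open>The homomorphism property makes every output a projection or a constant. Injectivity of
  the resulting \<open>p\<close> comes from interval preservation, applied to the whole
  cube.\<close>

lemma is_wiring_if_interval_preserving:
  assumes f: "f \<in> cube m \<rightarrow>\<^sub>E cube n"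
    and int: "interval_preserving (cube m) (cube n) f"
    and hom: "lattice_homomorphism (cube m) (cube n) f"
  shows "is_wiring m n f"
proof -
  define I where "I = {i. i < n \<and> (\<exists>j<m. \<forall>x\<in>cube m. f x i = x j)}"
  obtain p where p: "\<And>i. i \<in> I \<Longrightarrow> p i < m" "\<And>i x. i \<in> I \<Longrightarrow> x \<in> cube m \<Longrightarrow> f x i = x (p i)"
  proof -
    have "\<forall>i\<in>I. \<exists>j. j < m \<and> (\<forall>x\<in>cube m. f x i = x j)" by (auto simp: I_def)
    then show thesis using that by (metis bchoice)
  qed
  obtain c where c: "\<And>i x. i < n \<Longrightarrow> i \<notin> I \<Longrightarrow> x \<in> cube m \<Longrightarrow> f x i = c i"
  proof -
    have "\<forall>i\<in>{..<n} - I. \<exists>c. \<forall>x\<in>cube m. f x i = c"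
      using lattice_homomorphism_coordinate[OF hom] by (auto simp: I_def)
    then show thesis using that by (metis DiffI bchoice lessThan_iff)
  qed
  show ?thesis
  proof (rule is_wiringI)
    show "I \<subseteq> {..<n}" by (auto simp: I_def)
    show "p \<in> I \<rightarrow> {..<m}" using p by auto
    show "f = wiring m n I p c" by (rule eq_wiringI[OF f]) (simp add: p c)
    show "inj_on p I"
    proof (rule inj_onI, rule ccontr)
      fix i i' assume i: "i \<in> I" "i' \<in> I" "p i = p i'" "i \<noteq> i'"
      let ?o = "\<lambda>j\<in>{..<m}. False" and ?t = "\<lambda>j\<in>{..<m}. True"
      \<comment> \<open>If \<open>i\<close> and \<open>i'\<close> copied the same input, they would
        agree at every image point. \<open>?y\<close> differs from \<open>f ?o\<close> at
        \<open>i\<close> alone, so it separates them, yet it lies between \<open>f ?o\<close> and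
        \<open>f ?t\<close>.\<close>
      let ?y = "(f ?o)(i := True)"
      have n: "i < n" using i by (simp add: I_def)
      have fo: "f ?o \<in> cube n" "f ?t \<in> cube n" using PiE_mem[OF f] by simp_all
      then have y: "?y \<in> cube n" using n by (auto simp: cube_def PiE_def extensional_def)
      have "?o \<le> ?t" by (simp add: le_cube_iff[of _ m])
      then have "f ?o \<le> f ?t"
        using int mono_onD[of "cube m" f ?o ?t] unfolding interval_preserving_def by simp
      moreover have "f ?t i" using i p by simp
      ultimately have "f ?o \<le> ?y" "?y \<le> f ?t" by (auto simp: le_fun_def)
      moreover have "interval_in (cube n) (f ` cube m)"
        using int interval_in_cube unfolding interval_preserving_def by blast
      ultimately have "?y \<in> f ` cube m"
        using y unfolding interval_in_def by (meson imageI restrict_in_cube)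
      then obtain x where x: "x \<in> cube m" "?y = f x" by blast
      have "x (p i)" using p(2)[OF i(1) x(1)] x(2)[symmetric] by simp
      moreover have "\<not> x (p i')"
        \<comment> \<open>At \<open>i'\<close> the point \<open>?y\<close> still has the value of
          \<open>f ?o\<close>, which is false because \<open>i'\<close> copies an input of the
          bottom vertex.\<close>
        using p(2)[OF i(2) x(1)] x(2)[symmetric] i(4) p(1)[OF i(2)] p(2)[OF i(2), of ?o] by simp
      ultimately show False using i(3) by simp
    qed
  qed
qed

theorem theorem3p9:
  fixes m n :: nat and \<phi> :: "vertex \<Rightarrow> vertex"
  assumes "\<phi> \<in> cube m \<rightarrow>\<^sub>E cube n"
  shows "(interval_preserving (cube m) (cube n) \<phi> \<and> lattice_homomorphism (cube m) (cube n) \<phi>)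
    \<longleftrightarrow> box_morphism m n \<phi>"
  using assms is_wiring_if_interval_preserving interval_preserving_wiring
    lattice_homomorphism_wiring
  unfolding box_morphism_iff_is_wiring is_wiring_def by metis

end
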